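(* Let $\ell,m,n$ be positive integers. Let $f:N\to U$ be a $C^1$ injection of a $C^1$ manifold $N$ of dimension $n$ into an open subset $U$ of $\mathbb{R}^m$. Let $F:U\to\mathbb{R}^\ell$ be a $C^1$ mapping. If $\ell>2n$, then there exists a subset $\Sigma$ of $\mathcal{L}(\mathbb{R}^m,\mathbb{R}^\ell)$ with Lebesgue measure zero such that for any $\pi\in\mathcal{L}(\mathbb{R}^m,\mathbb{R}^\ell)-\Sigma$, the $C^1$ mapping $F_\pi\circ f:N\to\mathbb{R}^\ell$ is injective.
   Context: All manifolds are without boundary and have countable bases. A $C^1$ injection is an injective $C^1$ mapping (not necessarily an immersion). $\mathcal{L}(\mathbb{R}^m,\mathbb{R}^\ell)$ is the space of all linear mappings $\mathbb{R}^m\to\mathbb{R}^\ell$, naturally identified with $(\mathbb{R}^m)^\ell$, which gives the meaning of Lebesgue measure zero. For $\pi\in\mathcal{L}(\mathbb{R}^m,\mathbb{R}^\ell)$, $F_\pi=F+\pi|_U:U\to\mathbb{R}^\ell$. *)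

theory Defs
  imports "HOL-Analysis.Analysis"
begin

(* Meant for open S: the derivative is taken in the full neighbourhood filter "at x". *)
definition C1_on :: "'a::real_normed_vector set \<Rightarrow> ('a \<Rightarrow> 'b::real_normed_vector) \<Rightarrow> bool"
  where "C1_on S g \<longleftrightarrow>
    (\<exists>g' :: 'a \<Rightarrow> 'a \<Rightarrow>\<^sub>L 'b.
        (\<forall>x\<in>S. (g has_derivative blinfun_apply (g' x)) (at x)) \<and> continuous_on S g')"

(* A chart is a pair (V, phi); only the values of phi on V are relevant. *)
type_synonym ('a, 'n) chart = "'a set \<times> ('a \<Rightarrow> real ^ 'n)"

definition is_chart :: "'a topology \<Rightarrow> ('a, 'n::finite) chart \<Rightarrow> bool"
  where "is_chart N c \<longleftrightarrow>
    (case c of (V, \<phi>) \<Rightarrow>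
       openin N V \<and> open (\<phi> ` V) \<and>
       homeomorphic_map (subtopology N V) (top_of_set (\<phi> ` V)) \<phi>)"

(* A C^1 manifold without boundary, of dimension CARD('n), with a countable basis. The atlas A
   need not be maximal; it determines the C^1 structure. *)
definition C1_manifold :: "'a topology \<Rightarrow> ('a, 'n::finite) chart set \<Rightarrow> bool"
  where "C1_manifold N A \<longleftrightarrow>
    Hausdorff_space N \<and> second_countable N \<and>
    (\<forall>c\<in>A. is_chart N c) \<and>
    (\<Union>(V, \<phi>)\<in>A. V) = topspace N \<and>
    (\<forall>(V, \<phi>)\<in>A. \<forall>(W, \<psi>)\<in>A. C1_on (\<phi> ` (V \<inter> W)) (\<psi> \<circ> inv_into V \<phi>))"

(* C^1 mappings from the manifold with atlas A into a Euclidean space. *)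
definition C1_map :: "('a, 'n::finite) chart set \<Rightarrow> ('a \<Rightarrow> real ^ 'm) \<Rightarrow> bool"
  where "C1_map A f \<longleftrightarrow> (\<forall>(V, \<phi>)\<in>A. C1_on (\<phi> ` V) (f \<circ> inv_into V \<phi>))"

(* Mappings into the open submanifold U of a Euclidean space; no immersion condition. *)
definition C1_injection ::
    "'a topology \<Rightarrow> ('a, 'n::finite) chart set \<Rightarrow> (real ^ 'm) set \<Rightarrow> ('a \<Rightarrow> real ^ 'm) \<Rightarrow> bool"
  where "C1_injection N A U f \<longleftrightarrow>
    f ` topspace N \<subseteq> U \<and> C1_map A f \<and> inj_on f (topspace N)"

definition linear_maps :: "(real ^ 'm \<Rightarrow> real ^ 'l) set"
  where "linear_maps = {\<pi>. linear \<pi>}"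

(* Lebesgue measure zero under the identification of a linear map R^m -> R^l with the
   element of (R^m)^l listing the rows of its matrix. *)
definition linear_maps_null :: "(real ^ 'm \<Rightarrow> real ^ 'l) set \<Rightarrow> bool"
  where "linear_maps_null S \<longleftrightarrow> S \<subseteq> linear_maps \<and> matrix ` S \<in> null_sets lebesgue"

definition perturb :: "(real ^ 'm \<Rightarrow> real ^ 'l) \<Rightarrow> (real ^ 'm \<Rightarrow> real ^ 'l) \<Rightarrow> real ^ 'm \<Rightarrow> real ^ 'l"
  where "perturb F \<pi> = (\<lambda>x. F x + \<pi> x)"

end

theory Submission
  imports Defs
begin

text \<open>If \<open>F\<^sub>\<pi> \<circ> f\<close> identifies two points \<open>p\<close> and \<open>q\<close>, then \<open>u = f p - f q\<close> is nonzero, say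
  \<open>u\<^sub>k \<noteq> 0\<close>, and column \<open>k\<close> of the matrix of \<open>\<pi>\<close> is determined by \<open>p\<close>, \<open>q\<close> and the remaining
  columns. So the bad matrices are covered by countably many differentiable images of sets with
  \<open>2n + (m - 1)l < ml\<close> parameters. To get an image of a negligible set under a map from the
  space of matrices to itself, the \<open>2n < l\<close> chart coordinates of \<open>p\<close> and \<open>q\<close> are stored in
  column \<open>k\<close>, which leaves at least one entry of that column unused.\<close>

section \<open>Exceptional matrices for maps between Euclidean spaces\<close>

lemma differentiable_vec_nth:
  fixes f :: "'a::real_normed_vector \<Rightarrow> real ^ 'n"
  assumes "f differentiable F"
  shows "(\<lambda>x. f x $ i) differentiable F"
  using assms bounded_linear.has_derivative[OF bounded_linear_vec_nth]
  unfolding differentiable_def by blast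

lemma differentiable_vec_lambda:
  fixes f :: "'a::euclidean_space \<Rightarrow> 'n::finite \<Rightarrow> 'b::euclidean_space"
  assumes "\<And>i. (\<lambda>x. f x i) differentiable (at a within S)"
  shows "(\<lambda>x. \<chi> i. f x i) differentiable (at a within S)"
  using assms
  by (subst differentiable_componentwise_within)
    (auto simp: Basis_vec_def inner_axis intro!: differentiable_inner)

lemma negligible_noninjective_matrices_column:
  fixes g h :: "real ^ 'n::finite \<Rightarrow> real ^ 'm::finite"
    and F :: "real ^ 'm \<Rightarrow> real ^ 'l::finite"
  assumes g: "\<And>x. x \<in> P \<Longrightarrow> g differentiable at x" "\<And>x. x \<in> P \<Longrightarrow> F differentiable at (g x)"
    and h: "\<And>y. y \<in> Q \<Longrightarrow> h differentiable at y" "\<And>y. y \<in> Q \<Longrightarrow> F differentiable at (h y)"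
    and dim: "CARD('l) > 2 * CARD('n)"
  shows "negligible {M :: real ^ 'm ^ 'l. \<exists>x\<in>P. \<exists>y\<in>Q. g x $ k \<noteq> h y $ k \<and>
           F (g x) + M *v g x = F (h y) + M *v h y}"
    (is "negligible ?B")
proof -
  \<comment> \<open>The type \<open>'n + 'n\<close> indexes the coordinates of a pair of chart
    points. Each gets its own row through \<open>e\<close>, and by the strict inequality in
    \<open>dim\<close> some row \<open>i0\<close> stays free.\<close>
  have "card (UNIV :: ('n + 'n) set) \<le> card (UNIV :: 'l set)"
    using dim by simp
  then obtain e :: "'n + 'n \<Rightarrow> 'l" where e: "inj e"
    by (metis card_le_inj finite)
  have "card (range e) < CARD('l)"
    using dim by (simp add: card_image[OF e])
  then obtain i0 where i0: "i0 \<notin> range e"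
    by (metis UNIV_eq_I less_irrefl)
  \<comment> \<open>\<open>p\<close> and \<open>q\<close> decode the two chart points from column
    \<open>k\<close>.\<close>
  define p :: "real ^ 'm ^ 'l \<Rightarrow> real ^ 'n" where "p X = (\<chi> a. X $ e (Inl a) $ k)" for X
  define q :: "real ^ 'm ^ 'l \<Rightarrow> real ^ 'n" where "q X = (\<chi> a. X $ e (Inr a) $ k)" for X
  \<comment> \<open>Fixing the free entry at 0 puts \<open>S\<close> into a coordinate hyperplane,
    so \<open>S\<close> is negligible. The last condition keeps the denominator in \<open>G\<close>
    nonzero.\<close>
  define S where "S = {X. X $ i0 $ k = 0 \<and> p X \<in> P \<and> q X \<in> Q \<and> g (p X) $ k \<noteq> h (q X) $ k}"
  \<comment> \<open>Row \<open>i\<close> of the coincidence equation, solved for the entry in column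
    \<open>k\<close>; all other columns are copied from \<open>X\<close>.\<close>
  define G :: "real ^ 'm ^ 'l \<Rightarrow> real ^ 'm ^ 'l" where
    "G X = (\<chi> i j. if j = k
        then (F (h (q X)) $ i - F (g (p X)) $ i
               - (\<Sum>j\<in>UNIV - {k}. X $ i $ j * (g (p X) $ j - h (q X) $ j)))
             / (g (p X) $ k - h (q X) $ k)
        else X $ i $ j)" for X
  have nth: "(\<lambda>X :: real ^ 'm ^ 'l. X $ i $ j) differentiable at X" for i j X
    by (intro bounded_linear_imp_differentiable bounded_linear_vec_nth
        bounded_linear_compose[OF bounded_linear_vec_nth])
  have "axis i0 (axis k 1) \<in> (Basis :: (real ^ 'm ^ 'l) set)"
    by (simp add: axis_in_Basis_iff)
  then have "negligible {X :: real ^ 'm ^ 'l. X \<bullet> axis i0 (axis k 1) = 0}"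
    by (rule negligible_standard_hyperplane)
  then have "negligible S"
    by (rule negligible_subset) (auto simp: S_def inner_axis)
  moreover have "G differentiable at X" if X: "X \<in> S" for X
  proof -
    have p: "p differentiable at X" and q: "q differentiable at X"
      unfolding p_def q_def by (intro differentiable_vec_lambda nth)+
    have gp: "(\<lambda>X. g (p X)) differentiable at X" and hq: "(\<lambda>X. h (q X)) differentiable at X"
      using differentiable_chain_at[OF p] differentiable_chain_at[OF q] g(1) h(1) X
      by (auto simp: S_def o_def)
    have "(\<lambda>X. F (g (p X))) differentiable at X" "(\<lambda>X. F (h (q X))) differentiable at X"
      using differentiable_chain_at[OF gp] differentiable_chain_at[OF hq] g(2) h(2) X
      by (auto simp: S_def o_def)
    note d = differentiable_vec_nth[OF this(1)] differentiable_vec_nth[OF this(2)]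
      differentiable_vec_nth[OF gp] differentiable_vec_nth[OF hq] nth
    have "(\<lambda>X. if j = k
        then (F (h (q X)) $ i - F (g (p X)) $ i
               - (\<Sum>j\<in>UNIV - {k}. X $ i $ j * (g (p X) $ j - h (q X) $ j)))
             / (g (p X) $ k - h (q X) $ k)
        else X $ i $ j) differentiable at X" for i j
      using X by (cases "j = k")
        (auto simp: S_def intro!: differentiable_divide differentiable_diff differentiable_sum
          differentiable_mult d)
    then show ?thesis
      unfolding G_def by (intro differentiable_vec_lambda)
  qed
  then have "G differentiable_on S"
    by (simp add: differentiable_at_imp_differentiable_on)
  \<comment> \<open>Source and target of \<open>G\<close> have the same dimension, so a
    differentiable image of a negligible set is negligible.\<close>
  ultimately have "negligible (G ` S)"
    by (intro negligible_differentiable_image_negligible) auto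
  moreover have "?B \<subseteq> G ` S"
  proof
    fix M assume "M \<in> ?B"
    then obtain x y where x: "x \<in> P" and y: "y \<in> Q" and ne: "g x $ k \<noteq> h y $ k"
      and eq: "F (g x) + M *v g x = F (h y) + M *v h y"
      by blast
    \<comment> \<open>The code of \<open>M\<close>: column \<open>k\<close> is overwritten by the
      coordinates of \<open>x\<close> and \<open>y\<close>. Rows outside \<open>range e\<close>,
      among them \<open>i0\<close>, receive 0, as membership in \<open>S\<close> demands.\<close>
    define X :: "real ^ 'm ^ 'l" where
      "X = (\<chi> i j. if j = k
          then (if i \<in> range e then (case inv e i of Inl a \<Rightarrow> x $ a | Inr a \<Rightarrow> y $ a) else 0)
          else M $ i $ j)"
    have pX: "p X = x" and qX: "q X = y"
      using e by (simp_all add: p_def q_def X_def)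
    have "X \<in> S"
      using i0 x y ne by (simp add: S_def pX qX) (simp add: X_def)
    moreover have "G X = M"
    proof -
      \<comment> \<open>\<open>X\<close> and \<open>M\<close> agree off column \<open>k\<close>, so
        splitting the term \<open>j = k\<close> from row \<open>i\<close> of \<open>eq\<close>
        recovers the overwritten entry of \<open>M\<close>.\<close>
      have "F (h y) $ i - F (g x) $ i - (\<Sum>j\<in>UNIV - {k}. X $ i $ j * (g x $ j - h y $ j))
          = M $ i $ k * (g x $ k - h y $ k)" for i
      proof -
        have "F (h y) $ i - F (g x) $ i = (M *v g x) $ i - (M *v h y) $ i"
          using arg_cong[OF eq, of "\<lambda>v. v $ i"] by simp
        also have "\<dots> = (\<Sum>j\<in>UNIV. M $ i $ j * (g x $ j - h y $ j))"
          by (simp add: matrix_vector_mult_def sum_subtractf right_diff_distrib)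
        also have "\<dots> = M $ i $ k * (g x $ k - h y $ k)
            + (\<Sum>j\<in>UNIV - {k}. M $ i $ j * (g x $ j - h y $ j))"
          by (simp add: sum.remove)
        also have "(\<Sum>j\<in>UNIV - {k}. M $ i $ j * (g x $ j - h y $ j))
            = (\<Sum>j\<in>UNIV - {k}. X $ i $ j * (g x $ j - h y $ j))"
          by (intro sum.cong) (auto simp: X_def)
        finally show ?thesis
          by simp
      qed
      then show ?thesis
        using ne by (simp add: vec_eq_iff G_def pX qX) (simp add: X_def)
    qed
    ultimately show "M \<in> G ` S"
      by blast
  qed
  ultimately show ?thesis
    by (rule negligible_subset)
qed

text \<open>Distinct vectors differ in some coordinate \<open>k\<close>, so the sets of the previous
  lemma, one for each of the finitely many \<open>k\<close>, cover this one.\<close>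

lemma negligible_noninjective_matrices:
  fixes g h :: "real ^ 'n::finite \<Rightarrow> real ^ 'm::finite"
    and F :: "real ^ 'm \<Rightarrow> real ^ 'l::finite"
  assumes "\<And>x. x \<in> P \<Longrightarrow> g differentiable at x" "\<And>x. x \<in> P \<Longrightarrow> F differentiable at (g x)"
    and "\<And>y. y \<in> Q \<Longrightarrow> h differentiable at y" "\<And>y. y \<in> Q \<Longrightarrow> F differentiable at (h y)"
    and "CARD('l) > 2 * CARD('n)"
  shows "negligible {M :: real ^ 'm ^ 'l. \<exists>x\<in>P. \<exists>y\<in>Q. g x \<noteq> h y \<and>
           F (g x) + M *v g x = F (h y) + M *v h y}"
    (is "negligible ?B")
proof -
  have "negligible (\<Union>k\<in>UNIV. {M :: real ^ 'm ^ 'l. \<exists>x\<in>P. \<exists>y\<in>Q. g x $ k \<noteq> h y $ k \<and>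
           F (g x) + M *v g x = F (h y) + M *v h y})"
    using negligible_noninjective_matrices_column[OF assms]
    by (intro negligible_Union) auto
  then show ?thesis
    by (rule negligible_subset) (auto simp: vec_eq_iff)
qed

section \<open>C^1 mappings, atlases and charts\<close>

lemma C1_on_imp_differentiable:
  assumes "C1_on S g" "x \<in> S"
  shows "g differentiable at x"
  using assms unfolding C1_on_def differentiable_def by blast

lemma C1_on_compose:
  assumes "C1_on T F" "C1_on S g" "g ` S \<subseteq> T"
  shows "C1_on S (F \<circ> g)"
proof -
  obtain F' where F': "\<And>y. y \<in> T \<Longrightarrow> (F has_derivative blinfun_apply (F' y)) (at y)"
    "continuous_on T F'"
    using assms(1) unfolding C1_on_def by blast
  obtain g' where g': "\<And>x. x \<in> S \<Longrightarrow> (g has_derivative blinfun_apply (g' x)) (at x)"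
    "continuous_on S g'"
    using assms(2) unfolding C1_on_def by blast
  have "continuous_on S g"
    using g'(1) by (meson continuous_at_imp_continuous_on has_derivative_continuous)
  then have "continuous_on S (\<lambda>x. F' (g x))"
    using continuous_on_compose2[OF F'(2)] assms(3) by blast
  then have "continuous_on S (\<lambda>x. F' (g x) o\<^sub>L g' x)"
    using g'(2) by (intro continuous_intros)
  moreover have "(F \<circ> g has_derivative blinfun_apply (F' (g x) o\<^sub>L g' x)) (at x)" if "x \<in> S" for x
    using diff_chain_at[OF g'(1)[OF that] F'(1)] that assms(3)
    by (auto simp: o_def blinfun_compose.rep_eq)
  ultimately show ?thesis
    unfolding C1_on_def by (intro exI[of _ "\<lambda>x. F' (g x) o\<^sub>L g' x"]) blast
qed

lemma C1_on_perturb: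
  assumes "C1_on U F" "linear \<pi>"
  shows "C1_on U (perturb F \<pi>)"
proof -
  obtain F' where F': "\<And>y. y \<in> U \<Longrightarrow> (F has_derivative blinfun_apply (F' y)) (at y)"
    "continuous_on U F'"
    using assms(1) unfolding C1_on_def by blast
  have \<pi>: "bounded_linear \<pi>"
    using assms(2) by (simp add: linear_conv_bounded_linear)
  have "(perturb F \<pi> has_derivative blinfun_apply (F' y + Blinfun \<pi>)) (at y)" if "y \<in> U" for y
    unfolding perturb_def
    using has_derivative_add[OF F'(1)[OF that] bounded_linear_imp_has_derivative[OF \<pi>]]
    by (simp add: plus_blinfun.rep_eq bounded_linear_Blinfun_apply[OF \<pi>])
  moreover have "continuous_on U (\<lambda>y. F' y + Blinfun \<pi>)"
    using F'(2) by (intro continuous_intros)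
  ultimately show ?thesis
    unfolding C1_on_def by (intro exI[of _ "\<lambda>y. F' y + Blinfun \<pi>"]) blast
qed

text \<open>Second countability gives the Lindelof property. Countably many charts mean countably
  many pairs of charts, so the union of their exceptional sets stays negligible.\<close>

lemma C1_manifold_countable_atlas:
  assumes "C1_manifold N A"
  obtains C where "countable C" "C \<subseteq> A" "topspace N \<subseteq> (\<Union>c\<in>C. fst c)"
proof -
  have "Lindelof_space N"
    using assms second_countable_imp_Lindelof_space by (auto simp: C1_manifold_def)
  moreover have "openin N V" if "V \<in> fst ` A" for V
    using assms that by (force simp: C1_manifold_def is_chart_def)
  moreover have "\<Union> (fst ` A) = topspace N"
    using assms by (force simp: C1_manifold_def)
  ultimately obtain \<V> where \<V>: "countable \<V>" "\<V> \<subseteq> fst ` A" "\<Union>\<V> = topspace N"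
    unfolding Lindelof_space_def by metis
  then obtain C where "countable C" "C \<subseteq> A" "\<V> = fst ` C"
    by (metis countable_subset_image)
  then show ?thesis
    using \<V>(3) by (intro that[of C]) simp_all
qed

text \<open>Ensures that \<open>inv_into V \<phi>\<close> really undoes \<open>\<phi>\<close> on
  \<open>V\<close>.\<close>

lemma is_chart_inj_on:
  assumes "is_chart N (V, \<phi>)"
  shows "inj_on \<phi> V"
proof -
  have "V \<subseteq> topspace N"
    using assms by (simp add: is_chart_def openin_subset)
  then show ?thesis
    using assms homeomorphic_imp_injective_map[of "subtopology N V" _ \<phi>]
    by (auto simp: is_chart_def inf_absorb2)
qed

section \<open>Passage from pairs of charts to the manifold\<close>

theorem corollary5:
  fixes N :: "'a topology"
    and A :: "('a, 'n::finite) chart set"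
    and U :: "(real ^ 'm::finite) set"
    and f :: "'a \<Rightarrow> real ^ 'm"
    and F :: "real ^ 'm \<Rightarrow> real ^ 'l::finite"
  assumes "C1_manifold N A"
    and "open U"
    and "C1_injection N A U f"
    and "C1_on U F"
    and "CARD('l) > 2 * CARD('n)"
  shows "\<exists>\<Sigma> :: (real ^ 'm \<Rightarrow> real ^ 'l) set. linear_maps_null \<Sigma> \<and>
    (\<forall>\<pi> \<in> linear_maps - \<Sigma>.
       C1_map A (perturb F \<pi> \<circ> f) \<and> inj_on (perturb F \<pi> \<circ> f) (topspace N))"
proof -
  obtain C where C: "countable C" "C \<subseteq> A" "topspace N \<subseteq> (\<Union>c\<in>C. fst c)"
    using C1_manifold_countable_atlas[OF assms(1)] .
  have chart: "is_chart N c" if "c \<in> A" for c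
    using assms(1) that by (auto simp: C1_manifold_def)
  have f: "f ` topspace N \<subseteq> U" "C1_map A f" "inj_on f (topspace N)"
    using assms(3) by (auto simp: C1_injection_def)
  \<comment> \<open>\<open>loc c\<close> is \<open>f\<close> read in the chart \<open>c\<close>, and
    \<open>dom c\<close> is the open coordinate domain of that chart.\<close>
  define loc where "loc c = f \<circ> inv_into (fst c) (snd c)" for c :: "('a, 'n) chart"
  define dom where "dom c = snd c ` fst c" for c :: "('a, 'n) chart"
  have loc_C1: "C1_on (dom c) (loc c)" if "c \<in> A" for c
    using f(2) that by (auto simp: C1_map_def loc_def dom_def split: prod.splits)
  have loc_eq: "loc c (snd c p) = f p" if "c \<in> A" "p \<in> fst c" for c p
    using is_chart_inj_on[of N "fst c" "snd c"] chart that by (simp add: loc_def)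
  have loc_U: "loc c ` dom c \<subseteq> U" if "c \<in> A" for c
  proof -
    have "fst c \<subseteq> topspace N"
      using chart[OF that] by (auto simp: is_chart_def split: prod.splits dest: openin_subset)
    then show ?thesis
      using f(1) loc_eq[OF that] by (auto simp: dom_def)
  qed
  \<comment> \<open>Matrices that identify two distinct image points of \<open>f\<close>, one seen
    in \<open>c\<close> and one in \<open>d\<close>; the case \<open>c = d\<close> is
    included.\<close>
  define B :: "('a, 'n) chart \<Rightarrow> ('a, 'n) chart \<Rightarrow> (real ^ 'm ^ 'l) set" where
    "B c d = {M. \<exists>x\<in>dom c. \<exists>y\<in>dom d. loc c x \<noteq> loc d y \<and>
       F (loc c x) + M *v loc c x = F (loc d y) + M *v loc d y}" for c d
  have diff: "loc c differentiable at x" "F differentiable at (loc c x)"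
    if "c \<in> C" "x \<in> dom c" for c x
    using that C(2) loc_C1 loc_U assms(4) by (blast intro: C1_on_imp_differentiable)+
  have "negligible (B c d)" if "c \<in> C" "d \<in> C" for c d
    unfolding B_def using diff that assms(5) by (intro negligible_noninjective_matrices)
  then have B: "negligible (\<Union>(c, d)\<in>C \<times> C. B c d)"
    using C(1) by (intro negligible_countable_Union) auto
  \<comment> \<open>The exact exceptional set: injectivity off it is immediate, and what remains is
    to show measure zero.\<close>
  define \<Sigma> :: "(real ^ 'm \<Rightarrow> real ^ 'l) set" where
    "\<Sigma> = {\<pi>. linear \<pi> \<and> \<not> inj_on (perturb F \<pi> \<circ> f) (topspace N)}"
  have "matrix ` \<Sigma> \<subseteq> (\<Union>(c, d)\<in>C \<times> C. B c d)"
  proof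
    fix M assume "M \<in> matrix ` \<Sigma>"
    then obtain \<pi> where \<pi>: "linear \<pi>" "\<not> inj_on (perturb F \<pi> \<circ> f) (topspace N)" "M = matrix \<pi>"
      by (auto simp: \<Sigma>_def)
    then obtain p q where pq: "p \<in> topspace N" "q \<in> topspace N" "p \<noteq> q"
      "F (f p) + \<pi> (f p) = F (f q) + \<pi> (f q)"
      by (auto simp: inj_on_def perturb_def)
    then obtain c d where cd: "c \<in> C" "p \<in> fst c" "d \<in> C" "q \<in> fst d"
      using C(3) by blast
    \<comment> \<open>Injectivity of \<open>f\<close> turns distinct points of the manifold into the
      distinct vectors that \<open>B\<close> requires.\<close>
    have "f p \<noteq> f q"
      using f(3) pq by (auto dest: inj_onD)
    moreover have "loc c (snd c p) = f p" "loc d (snd d q) = f q"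
      using loc_eq cd C(2) by blast+
    moreover have "M *v v = \<pi> v" for v
      using \<pi> by (simp add: matrix_works)
    ultimately have "M \<in> B c d"
      using cd pq(4) unfolding B_def dom_def mem_Collect_eq
      by (intro bexI[of _ "snd c p"] bexI[of _ "snd d q"]) simp_all
    then show "M \<in> (\<Union>(c, d)\<in>C \<times> C. B c d)"
      using cd by blast
  qed
  then have "negligible (matrix ` \<Sigma>)"
    using B negligible_subset by blast
  then have "linear_maps_null \<Sigma>"
    by (auto simp: linear_maps_null_def linear_maps_def \<Sigma>_def negligible_iff_null_sets)
  \<comment> \<open>Smoothness holds for every linear \<open>\<pi>\<close>, by the chain rule in
    each chart.\<close>
  moreover have "C1_map A (perturb F \<pi> \<circ> f)" if "linear \<pi>" for \<pi>
  proof -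
    have "C1_on (dom c) (perturb F \<pi> \<circ> loc c)" if "c \<in> A" for c
      using C1_on_compose[OF C1_on_perturb] assms(4) \<open>linear \<pi>\<close> loc_C1 loc_U that by blast
    then show ?thesis
      by (force simp: C1_map_def dom_def loc_def comp_assoc)
  qed
  ultimately show ?thesis
    by (intro exI[of _ \<Sigma>]) (auto simp: \<Sigma>_def linear_maps_def)
qed

end
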